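(* Let $\sigma\ge1$, let $\varphi=(\varphi_1,\dots,\varphi_b)$ be a solid $b$-fold $k$-coloring of $G_{[1,\sigma]}$, and let $(D_i)_{i\in[n]}$ be a sequence of disks with diameters in $[1,\sigma]$. Then algorithm FoldColor with $\varphi$ on input $(D_i)_{i\in[n]}$ returns a proper coloring of $G=G((D_i)_{i\in[n]})$.
   Context: $G_{[1,\sigma]}$ is the infinite graph on $\mathbb R^2$ with two points adjacent iff their distance lies in $[1,\sigma]$. A $b$-fold coloring of $G_{[1,\sigma]}$ with colors $[k]$ is a tuple $(\varphi_1,\dots,\varphi_b)$, $\varphi_r:\mathbb R^2\to[k]$, with $\varphi_r(p)\ne\varphi_s(p)$ for $r\ne s$ and $\varphi_r(p_1)\ne\varphi_s(p_2)$ for all $r,s$ whenever $\mathrm{dist}(p_1,p_2)\in[1,\sigma]$. It is solid if there are $b$ tilings of the plane into congruent tiles (the $r$-th tiling is the $r$-th layer) such that $\varphi_r$ is constant on each tile of the $r$-th tiling, any two points of one tile are at distance less than $1$, and distinct tiles of the same color (possibly from different layers) are at point-to-point distance greater than $\sigma$. For disks $(D_i)_{i\in[n]}$, $G((D_i))$ has one vertex $v_i$ per disk, identified with the center of $D_i$ (distinct disks give distinct vertices), with $v_iv_j$ an edge iff $D_i\cap D_j\ne\emptyset$. Algorithm FoldColor (online): when $D_i$ is read, for each $r\in[b]$ let $T_r(v_i)$ be the tile of layer $r$ containing $v_i$; let $m$ be the number of earlier vertices $v_1,\dots,v_{i-1}$ lying in $\bigcap_{r\in[b]}T_r(v_i)$;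 set $\ell(v_i)=1+(m\bmod b)$; let $t(v_i)$ be the number of earlier vertices $u$ lying in $T_{\ell(v_i)}(v_i)$ with $\ell(u)=\ell(v_i)$; assign $c(v_i)=\varphi_{\ell(v_i)}(v_i)+k\,t(v_i)$. *)

theory Defs
  imports "HOL-Analysis.Analysis"
begin

text \<open>Adjacency in the graph on the plane whose edges are the pairs at distance in \<open>[1, \<sigma>]\<close>.\<close>

definition dist_adj :: "real \<Rightarrow> real^2 \<Rightarrow> real^2 \<Rightarrow> bool" where
  "dist_adj \<sigma> p q \<longleftrightarrow> dist p q \<in> {1..\<sigma>}"

text \<open>Layers, colors and disks are all indexed from 1; values of \<open>\<phi>\<close> outside \<open>{1..b}\<close> are irrelevant.\<close>

definition fold_coloring :: "real \<Rightarrow> nat \<Rightarrow> nat \<Rightarrow> (nat \<Rightarrow> real^2 \<Rightarrow> nat) \<Rightarrow> bool" where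
  "fold_coloring \<sigma> b k \<phi> \<longleftrightarrow>
     (\<forall>r\<in>{1..b}. \<forall>p. \<phi> r p \<in> {1..k}) \<and>
     (\<forall>r\<in>{1..b}. \<forall>s\<in>{1..b}. \<forall>p. r \<noteq> s \<longrightarrow> \<phi> r p \<noteq> \<phi> s p) \<and>
     (\<forall>r\<in>{1..b}. \<forall>s\<in>{1..b}. \<forall>p q. dist_adj \<sigma> p q \<longrightarrow> \<phi> r p \<noteq> \<phi> s q)"

definition congruent_sets :: "(real^2) set \<Rightarrow> (real^2) set \<Rightarrow> bool" where
  "congruent_sets A B \<longleftrightarrow> (\<exists>f. (\<forall>x y. dist (f x) (f y) = dist x y) \<and> f ` A = B)"

text \<open>Tiles partition the plane, so boundary points belong to exactly one tile; this is what makes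
  ``the tile containing a point'' meaningful.\<close>

definition congruent_tiling :: "(real^2) set set \<Rightarrow> bool" where
  "congruent_tiling T \<longleftrightarrow>
     partition_on UNIV T \<and> (\<forall>A\<in>T. \<forall>B\<in>T. congruent_sets A B)"

text \<open>The tilings \<open>\<T> 1, \<dots>, \<T> b\<close> witness that \<open>\<phi>\<close> is solid. In the last clause \<open>\<phi> r p\<close> and
  \<open>\<phi> s q\<close> are the colors of the tiles \<open>A\<close> and \<open>B\<close>.\<close>

definition solid_tilings ::
    "real \<Rightarrow> nat \<Rightarrow> (nat \<Rightarrow> real^2 \<Rightarrow> nat) \<Rightarrow> (nat \<Rightarrow> (real^2) set set) \<Rightarrow> bool" where
  "solid_tilings \<sigma> b \<phi> \<T> \<longleftrightarrow>
     (\<forall>r\<in>{1..b}. congruent_tiling (\<T> r)) \<and>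
     (\<forall>r\<in>{1..b}. \<forall>A\<in>\<T> r. \<forall>p\<in>A. \<forall>q\<in>A. \<phi> r p = \<phi> r q) \<and>
     (\<forall>r\<in>{1..b}. \<forall>A\<in>\<T> r. \<forall>p\<in>A. \<forall>q\<in>A. dist p q < 1) \<and>
     (\<forall>r\<in>{1..b}. \<forall>s\<in>{1..b}. \<forall>A\<in>\<T> r. \<forall>B\<in>\<T> s. A \<noteq> B \<longrightarrow>
        (\<forall>p\<in>A. \<forall>q\<in>B. \<phi> r p = \<phi> s q \<longrightarrow> dist p q > \<sigma>))"

datatype disk = Disk (center: "real^2") (radius: real)

definition disk_points :: "disk \<Rightarrow> (real^2) set" where
  "disk_points D = cball (center D) (radius D)"

text \<open>The vertices of the disk graph are the indices in \<open>{1..n}\<close>, so concentric or repeated disks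
  still give distinct vertices.\<close>

definition disk_adj :: "(nat \<Rightarrow> disk) \<Rightarrow> nat \<Rightarrow> nat \<Rightarrow> bool" where
  "disk_adj D i j \<longleftrightarrow> i \<noteq> j \<and> disk_points (D i) \<inter> disk_points (D j) \<noteq> {}"

definition proper_coloring :: "'v set \<Rightarrow> ('v \<Rightarrow> 'v \<Rightarrow> bool) \<Rightarrow> ('v \<Rightarrow> 'c) \<Rightarrow> bool" where
  "proper_coloring V E c \<longleftrightarrow> (\<forall>u\<in>V. \<forall>v\<in>V. E u v \<longrightarrow> c u \<noteq> c v)"

definition tile_of :: "(nat \<Rightarrow> (real^2) set set) \<Rightarrow> nat \<Rightarrow> real^2 \<Rightarrow> (real^2) set" where
  "tile_of \<T> r p = (THE A. A \<in> \<T> r \<and> p \<in> A)"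

definition FoldColor_layer ::
    "nat \<Rightarrow> (nat \<Rightarrow> (real^2) set set) \<Rightarrow> (nat \<Rightarrow> disk) \<Rightarrow> nat \<Rightarrow> nat" where
  "FoldColor_layer b \<T> D i =
     1 + card {j \<in> {1..<i}. center (D j) \<in> (\<Inter>r\<in>{1..b}. tile_of \<T> r (center (D i)))} mod b"

definition FoldColor_count ::
    "nat \<Rightarrow> (nat \<Rightarrow> (real^2) set set) \<Rightarrow> (nat \<Rightarrow> disk) \<Rightarrow> nat \<Rightarrow> nat" where
  "FoldColor_count b \<T> D i =
     card {j \<in> {1..<i}.
       center (D j) \<in> tile_of \<T> (FoldColor_layer b \<T> D i) (center (D i)) \<and>
       FoldColor_layer b \<T> D j = FoldColor_layer b \<T> D i}"

text \<open>The color given to the \<open>i\<close>-th disk depends only on the disks with indices \<open>1, \<dots>, i\<close>.\<close>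

definition FoldColor ::
    "nat \<Rightarrow> nat \<Rightarrow> (nat \<Rightarrow> real^2 \<Rightarrow> nat) \<Rightarrow> (nat \<Rightarrow> (real^2) set set) \<Rightarrow> (nat \<Rightarrow> disk) \<Rightarrow> nat \<Rightarrow> nat"
  where
  "FoldColor b k \<phi> \<T> D i =
     \<phi> (FoldColor_layer b \<T> D i) (center (D i)) + k * FoldColor_count b \<T> D i"

end

theory Submission
  imports Defs
begin

text \<open>Let two adjacent vertices receive the same color. Since \<open>\<phi>\<close> takes values in \<open>{1..k}\<close>,
  both their \<open>\<phi>\<close>-values and their counters agree. The centers are at distance at most \<open>\<sigma>\<close>, so
  solidity forces the two tiles to be the same set. The layers then agree as well, since a set that
  is a tile of two layers would have the same color in both. But two vertices of the same tile and
  layer have different counters, the later one counting the earlier.\<close>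

text \<open>Covering gives existence and disjointness gives uniqueness, so the definite description
  in \<open>tile_of\<close> denotes an actual tile.\<close>

lemma tile_of_mem:
  assumes "partition_on UNIV (\<T> r)"
  shows "tile_of \<T> r p \<in> \<T> r" and "p \<in> tile_of \<T> r p"
proof -
  have "\<exists>!A. A \<in> \<T> r \<and> p \<in> A"
    using partition_onD1[OF assms] disjointD[OF partition_onD2[OF assms]] by blast
  then have "tile_of \<T> r p \<in> \<T> r \<and> p \<in> tile_of \<T> r p"
    unfolding tile_of_def by (rule theI')
  then show "tile_of \<T> r p \<in> \<T> r" and "p \<in> tile_of \<T> r p" by auto
qed

lemma dist_centers_le:
  assumes "diameter (disk_points A) \<le> \<sigma>" "diameter (disk_points B) \<le> \<sigma>"
    and "disk_points A \<inter> disk_points B \<noteq> {}"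
  shows "dist (center A) (center B) \<le> \<sigma>"
proof -
  obtain x where x: "dist (center A) x \<le> radius A" "dist (center B) x \<le> radius B"
    using assms(3) by (auto simp: disk_points_def)
  \<comment> \<open>A ball of negative radius is empty and has diameter 0; the common point
    \<open>x\<close> excludes this, so each diameter is twice the radius.\<close>
  then have "0 \<le> radius A" "0 \<le> radius B"
    using zero_le_dist order_trans by blast+
  then have "radius A + radius B \<le> \<sigma>"
    using assms(1,2) by (simp add: disk_points_def diameter_cball)
  then show ?thesis
    using x dist_triangle2[of "center A" "center B" x] by linarith
qed

lemma FoldColor_layer_range:
  assumes "b \<ge> 1"
  shows "FoldColor_layer b \<T> D i \<in> {1..b}"
proof -
  have "m mod b < b" for m using assms by simp
  then show ?thesis by (simp add: FoldColor_layer_def Suc_le_eq)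
qed

text \<open>The set counted for \<open>i\<close> lies inside the set counted for \<open>j\<close>,
  and \<open>i\<close> itself belongs only to the latter.\<close>

lemma FoldColor_count_less:
  assumes "1 \<le> i" "i < j"
    and layer: "FoldColor_layer b \<T> D i = FoldColor_layer b \<T> D j"
    and tile: "tile_of \<T> (FoldColor_layer b \<T> D i) (center (D i)) =
               tile_of \<T> (FoldColor_layer b \<T> D j) (center (D j))"
    and self: "center (D i) \<in> tile_of \<T> (FoldColor_layer b \<T> D i) (center (D i))"
  shows "FoldColor_count b \<T> D i < FoldColor_count b \<T> D j"
  unfolding FoldColor_count_def
proof (rule psubset_card_mono)
  show "{h \<in> {1..<i}. center (D h) \<in> tile_of \<T> (FoldColor_layer b \<T> D i) (center (D i)) \<and>
          FoldColor_layer b \<T> D h = FoldColor_layer b \<T> D i}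
      \<subset> {h \<in> {1..<j}. center (D h) \<in> tile_of \<T> (FoldColor_layer b \<T> D j) (center (D j)) \<and>
          FoldColor_layer b \<T> D h = FoldColor_layer b \<T> D j}" (is "?I \<subset> ?J")
  proof
    show "?I \<subseteq> ?J" using assms(2) layer tile by auto
    have "i \<in> ?J" "i \<notin> ?I" using assms(1,2) layer tile self by auto
    then show "?I \<noteq> ?J" by blast
  qed
qed simp

text \<open>Lowering \<open>x\<close> and \<open>y\<close> by 1 turns them into remainders below
  \<open>k\<close>, so division by \<open>k\<close> recovers \<open>s\<close> and
  \<open>t\<close>.\<close>

lemma add_mult_eq_imp_eq:
  fixes x y k s t :: nat
  assumes "x \<in> {1..k}" "y \<in> {1..k}" and "x + k * s = y + k * t"
  shows "x = y" and "s = t"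
proof -
  have div: "(z - 1 + k * u) div k = u" if "z \<in> {1..k}" for z u
  proof -
    have "z - 1 < k" using that by auto
    then show ?thesis by (subst div_mult_self2) auto
  qed
  have "x - 1 + k * s = y - 1 + k * t" using assms by auto
  then show "s = t" using div assms(1,2) by metis
  then show "x = y" using assms(3) by simp
qed

text \<open>Ordering the indices fixes which counter is larger. Centers may be closer than 1, where
  \<open>dist_adj\<close> says nothing, so the tiles must be compared.\<close>

lemma FoldColor_neq:
  assumes "b \<ge> 1" and fold: "fold_coloring \<sigma> b k \<phi>" and solid: "solid_tilings \<sigma> b \<phi> \<T>"
    and "1 \<le> i" "i < j" and dist: "dist (center (D i)) (center (D j)) \<le> \<sigma>"
  shows "FoldColor b k \<phi> \<T> D i \<noteq> FoldColor b k \<phi> \<T> D j"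
proof
  define r s where "r = FoldColor_layer b \<T> D i" and "s = FoldColor_layer b \<T> D j"
  define p q where "p = center (D i)" and "q = center (D j)"
  assume "FoldColor b k \<phi> \<T> D i = FoldColor b k \<phi> \<T> D j"
  then have eq: "\<phi> r p + k * FoldColor_count b \<T> D i = \<phi> s q + k * FoldColor_count b \<T> D j"
    by (simp add: FoldColor_def r_def s_def p_def q_def)
  have rs: "r \<in> {1..b}" "s \<in> {1..b}"
    unfolding r_def s_def using FoldColor_layer_range[OF \<open>b \<ge> 1\<close>] by blast+
  then have "\<phi> r p \<in> {1..k}" "\<phi> s q \<in> {1..k}"
    using fold by (simp_all add: fold_coloring_def)
  from add_mult_eq_imp_eq[OF this eq]
  have color: "\<phi> r p = \<phi> s q" and count: "FoldColor_count b \<T> D i = FoldColor_count b \<T> D j" .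
  have parts: "partition_on UNIV (\<T> r)" "partition_on UNIV (\<T> s)"
    using solid rs by (simp_all add: solid_tilings_def congruent_tiling_def)
  note A = tile_of_mem[of \<T> r p, OF parts(1)] and B = tile_of_mem[of \<T> s q, OF parts(2)]
  \<comment> \<open>Tiles of different layers are compared as sets here, so this clause alone cannot
    give \<open>r = s\<close>.\<close>
  have "\<forall>r\<in>{1..b}. \<forall>s\<in>{1..b}. \<forall>A\<in>\<T> r. \<forall>B\<in>\<T> s. A \<noteq> B \<longrightarrow>
      (\<forall>p\<in>A. \<forall>q\<in>B. \<phi> r p = \<phi> s q \<longrightarrow> dist p q > \<sigma>)"
    using solid unfolding solid_tilings_def by (elim conjE)
  then have "dist p q > \<sigma>" if "tile_of \<T> r p \<noteq> tile_of \<T> s q"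
    using rs A B that color by blast
  then have tile: "tile_of \<T> r p = tile_of \<T> s q"
    using dist by (force simp: p_def q_def)
  \<comment> \<open>The common tile contains both centers, so the color of layer \<open>s\<close>
    can be moved from \<open>q\<close> to \<open>p\<close>; distinct layers never share a color at a
    single point.\<close>
  have "\<forall>A\<in>\<T> s. \<forall>p\<in>A. \<forall>q\<in>A. \<phi> s p = \<phi> s q"
    using solid rs(2) unfolding solid_tilings_def by (elim conjE) (rule bspec)
  then have "\<phi> s p = \<phi> s q" using B A(2) tile by blast
  then have "\<phi> r p = \<phi> s p" using color by simp
  then have "r = s"
    using fold rs unfolding fold_coloring_def by blast
  then have "FoldColor_count b \<T> D i < FoldColor_count b \<T> D j"
    using tile A(2) unfolding r_def s_def p_def q_def
    by (intro FoldColor_count_less[OF assms(4,5)])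
  then show False using count by simp
qed

theorem mainTheorem9:
  fixes \<sigma> :: real and b k n :: nat
    and \<phi> :: "nat \<Rightarrow> real^2 \<Rightarrow> nat"
    and \<T> :: "nat \<Rightarrow> (real^2) set set"
    and D :: "nat \<Rightarrow> disk"
  assumes "\<sigma> \<ge> 1" and "b \<ge> 1"
    and "fold_coloring \<sigma> b k \<phi>"
    and "solid_tilings \<sigma> b \<phi> \<T>"
    and "\<And>i. i \<in> {1..n} \<Longrightarrow> diameter (disk_points (D i)) \<in> {1..\<sigma>}"
  shows "proper_coloring {1..n} (disk_adj D) (FoldColor b k \<phi> \<T> D)"
  unfolding proper_coloring_def
proof (intro ballI impI)
  fix i j
  assume ij: "i \<in> {1..n}" "j \<in> {1..n}" and adj: "disk_adj D i j"
  then have dist: "dist (center (D i)) (center (D j)) \<le> \<sigma>"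
    using assms(5)[of i] assms(5)[of j] by (intro dist_centers_le) (auto simp: disk_adj_def)
  note neq = FoldColor_neq[OF assms(2-4)]
  consider "i < j" | "j < i" using adj by (force simp: disk_adj_def)
  then show "FoldColor b k \<phi> \<T> D i \<noteq> FoldColor b k \<phi> \<T> D j"
  proof cases
    case 1
    then show ?thesis using neq[of i j D] ij dist by simp
  next
    case 2
    then show ?thesis using neq[of j i D] ij dist by (simp add: dist_commute)
  qed
qed

end
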